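(* Let $\mathcal{I}=[a,b]$ with $0\le a<b$, and let $\rho\ne-1$ and $\nu>1$ be real numbers. Let $F:\mathcal{I}\rightrightarrows\mathbb{R}$ be a set-valued map with nonempty compact convex values which is Borel measurable and integrably bounded on $\mathcal{I}$, and let ${}_a^{\rho}\mathfrak{D}^{\nu}F$ be its set-valued Katugampola integral. Suppose $F$ is of bounded variation on $\mathcal{I}$ with respect to the Hausdorff metric $H_d$. Then the set-valued mapping $t\mapsto{}_a^{\rho}\mathfrak{D}^{\nu}F(t)$ admits a continuous selection $h:\mathcal{I}\to\mathbb{R}$ that is also of bounded variation on $\mathcal{I}$.
   Context: A set-valued map $G:\mathcal{I}\rightrightarrows\mathbb{R}$ assigns to each $t\in\mathcal{I}$ a subset $G(t)\subset\mathbb{R}$; Borel measurability of set-valued maps is in the usual sense. An (integrable) selection of $G$ is a single-valued measurable function $g:\mathcal{I}\to\mathbb{R}$ with $g(t)\in G(t)$ for a.e. $t$ and $g\in L^1(\mathcal{I})$; $\mathfrak{I}$ denotes the collection of all integrable selections of $F$. $F$ is integrably bounded if there is an integrable function $m:\mathcal{I}\to\mathbb{R}$ such that $|s|\le m(t)$ for all $t\in\mathcal{I}$ and all $s\in F(t)$. The set-valued Katugampola fractional integral of $F$ (for real $\nu>0$, $\rho\ne-1$) is $${}_a^{\rho}\mathfrak{D}^{\nu}F(t)=\left\{\frac{(\rho+1)^{1-\nu}}{\Gamma(\nu)}\int_a^t (t^{\rho+1}-x^{\rho+1})^{\nu-1}x^{\rho}f(x)\,dx : f\in\mathfrak{I}\right\},\quad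 t\in\mathcal{I}.$$ For nonempty compact $A_1,A_2\subset\mathbb{R}$, $H_d(A_1,A_2)=\max\{\sup_{a_2\in A_2}\inf_{a_1\in A_1}|a_1-a_2|,\ \sup_{a_1\in A_1}\inf_{a_2\in A_2}|a_1-a_2|\}$. A map $G$ on $[a,b]$ with nonempty compact values in $\mathbb{R}$ is of bounded variation with respect to $H_d$ if $V_a^b(G)=\sup\sum_{i=1}^n H_d(G(t_i),G(t_{i-1}))<\infty$, the supremum being over all partitions $a=t_0<t_1<\dots<t_n=b$.
   Formalization: For a=0 and ρ<-1 the integral can diverge (e.g. F={1}, ρ=-2, ν=2), so the set-valued integral is undefined; divergent integrals are given the value 0. For ρ<-1 powers of negative bases are read as powers of absolute values. *)

theory Defs
  imports "HOL-Analysis.Analysis"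
begin

text \<open>
  A set-valued map on \<open>[a,b]\<close> is a total function \<open>real \<Rightarrow> real set\<close>; only its values on
  \<open>{a..b}\<close> are ever used.
\<close>

definition borel_measurable_set_valued :: "real \<Rightarrow> real \<Rightarrow> (real \<Rightarrow> real set) \<Rightarrow> bool" where
  "borel_measurable_set_valued a b F \<longleftrightarrow>
     (\<forall>U. open U \<longrightarrow> {t \<in> {a..b}. F t \<inter> U \<noteq> {}} \<in> sets borel)"

definition integrably_bounded :: "real \<Rightarrow> real \<Rightarrow> (real \<Rightarrow> real set) \<Rightarrow> bool" where
  "integrably_bounded a b F \<longleftrightarrow>
     (\<exists>m :: real \<Rightarrow> real. integrable (lebesgue_on {a..b}) m \<and>
        (\<forall>t\<in>{a..b}. \<forall>s\<in>F t. \<bar>s\<bar> \<le> m t))"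

definition integrable_selections :: "real \<Rightarrow> real \<Rightarrow> (real \<Rightarrow> real set) \<Rightarrow> (real \<Rightarrow> real) set" where
  "integrable_selections a b F =
     {f. integrable (lebesgue_on {a..b}) f \<and> (AE t in lebesgue_on {a..b}. f t \<in> F t)}"

text \<open>
  For \<open>\<rho> < -1\<close> both \<open>\<rho> + 1\<close> and \<open>t powr (\<rho> + 1) - x powr (\<rho> + 1)\<close> (with \<open>0 < x < t\<close>) are
  negative. On the reals, \<open>y powr c\<close> is \<open>exp (c * ln \<bar>y\<bar>)\<close> for \<open>y \<noteq> 0\<close>, so the two powers
  below combine to the power of the positive quotient (lemma \<open>katugampola_powers\<close>). The principal
  branches of the complex powers have the same product, since their phases cancel.

  The Bochner integral is \<open>0\<close> on non-integrable functions. If \<open>F\<close> is bounded, \<open>\<nu> \<ge> 1\<close>, and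
  \<open>0 < a\<close> or \<open>-1 < \<rho>\<close>, the integrand is integrable for every integrable selection of \<open>F\<close>. If
  \<open>a = 0\<close> and \<open>\<rho> < -1\<close>, it need not be.
\<close>

definition katugampola_integral ::
  "real \<Rightarrow> real \<Rightarrow> real \<Rightarrow> (real \<Rightarrow> real) \<Rightarrow> real \<Rightarrow> real" where
  "katugampola_integral a \<rho> \<nu> f t =
     (\<rho> + 1) powr (1 - \<nu>) / Gamma \<nu> *
     (\<integral>x. (t powr (\<rho> + 1) - x powr (\<rho> + 1)) powr (\<nu> - 1) * x powr \<rho> * f x
        \<partial>lebesgue_on {a..t})"

definition set_katugampola_integral ::
  "real \<Rightarrow> real \<Rightarrow> real \<Rightarrow> real \<Rightarrow> (real \<Rightarrow> real set) \<Rightarrow> real \<Rightarrow> real set" where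
  "set_katugampola_integral a b \<rho> \<nu> F t =
     {katugampola_integral a \<rho> \<nu> f t | f. f \<in> integrable_selections a b F}"

lemma katugampola_powers:
  fixes \<rho> \<nu> d :: real
  assumes "\<rho> \<noteq> -1"
  shows "(\<rho> + 1) powr (1 - \<nu>) * d powr (\<nu> - 1) = (d / (\<rho> + 1)) powr (\<nu> - 1)"
proof (cases "d = 0")
  case False
  with assms have "\<rho> + 1 \<noteq> 0" by simp
  with False show ?thesis
    by (simp add: powr_def ln_div exp_add [symmetric] algebra_simps)
qed simp

text \<open>The suprema and infima are in \<open>real\<close>, hence meaningful for nonempty bounded sets.\<close>

definition hausdorff_metric :: "real set \<Rightarrow> real set \<Rightarrow> real" where
  "hausdorff_metric A1 A2 =
     max (SUP a2\<in>A2. INF a1\<in>A1. \<bar>a1 - a2\<bar>) (SUP a1\<in>A1. INF a2\<in>A2. \<bar>a1 - a2\<bar>)"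

definition partitions :: "real \<Rightarrow> real \<Rightarrow> (nat \<times> (nat \<Rightarrow> real)) set" where
  "partitions a b = {(n, t). t 0 = a \<and> t n = b \<and> (\<forall>i<n. t i < t (Suc i))}"

text \<open>
  Total variation with respect to a distance \<open>d\<close>: used with \<open>hausdorff_metric\<close> for set-valued
  maps and with \<open>dist\<close> for real functions.
\<close>

definition total_variation ::
  "('a \<Rightarrow> 'a \<Rightarrow> real) \<Rightarrow> real \<Rightarrow> real \<Rightarrow> (real \<Rightarrow> 'a) \<Rightarrow> ereal" where
  "total_variation d a b G =
     (SUP (n, t)\<in>partitions a b. ereal (\<Sum>i=1..n. d (G (t i)) (G (t (i - 1)))))"

definition bounded_variation ::
  "('a \<Rightarrow> 'a \<Rightarrow> real) \<Rightarrow> real \<Rightarrow> real \<Rightarrow> (real \<Rightarrow> 'a) \<Rightarrow> bool" where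
  "bounded_variation d a b G \<longleftrightarrow> total_variation d a b G < \<infinity>"

end

theory Submission
  imports Defs
begin

text \<open>
  A single selection serves for all \<open>t\<close>: take \<open>f t = Sup (F t)\<close>. On \<open>{a..b}\<close>, extended by zero for
  \<open>x > t\<close>, the Katugampola kernel \<open>k t x\<close> is nonnegative and, for fixed \<open>x\<close>, continuous and
  nondecreasing in \<open>t\<close>. If \<open>k b x * f x\<close> is integrable in \<open>x\<close>, it dominates all \<open>k t x * f x\<close>; so
  \<open>h t = (\<integral>x. k t x * f x)\<close> is continuous, and its increments are bounded by those of the monotone
  function \<open>t \<mapsto> (\<integral>x. k t x * \<bar>f x\<bar>)\<close>. If it is not integrable (possible for \<open>a = 0\<close>), then
  \<open>k t x * f x\<close> is not integrable for any \<open>t > a\<close>, because \<open>k b\<close> is bounded by a multiple of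
  \<open>k t\<close> near \<open>a\<close> and by a constant away from \<open>a\<close>. Then \<open>h\<close> vanishes identically, the
  Bochner integral being zero on non-integrable functions.
\<close>

text \<open>Real \<open>ln\<close> is even, so \<open>powr\<close> ignores the sign of its base. The
  kernel may therefore carry an absolute value where the difference of powers is negative, as for
  \<rho> < -1.\<close>

lemma powr_abs: "\<bar>d\<bar> powr p = d powr p" for d p :: real
  by (simp add: powr_def abs_if ln_minus)

section \<open>Partitions and total variation\<close>

lemma partition_mono:
  assumes "(n, t) \<in> partitions a b" "i \<le> j" "j \<le> n"
  shows "t i \<le> t j"
  using assms(2,3)
proof (induction j rule: dec_induct)
  case (step k)
  then have "t k < t (Suc k)"
    using assms(1) by (auto simp: partitions_def)
  with step show ?case by simp
qed simp

lemma partition_in_interval: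
  assumes "(n, t) \<in> partitions a b" "i \<le> n"
  shows "t i \<in> {a..b}"
  using partition_mono[OF assms(1), of 0 i] partition_mono[OF assms(1), of i n] assms
  by (auto simp: partitions_def)

lemma bounded_variation_cong:
  assumes "\<And>t. t \<in> {a..b} \<Longrightarrow> g t = h t"
  shows "bounded_variation d a b g = bounded_variation d a b h"
proof -
  have "total_variation d a b g = total_variation d a b h"
    unfolding total_variation_def
  proof (intro SUP_cong, simp, clarify, intro arg_cong[where f = ereal] sum.cong refl)
    fix n t i assume part: "(n, t) \<in> partitions a b" and "i \<in> {1..n}"
    then have "i \<le> n" "i - 1 \<le> n" by auto
    then show "d (g (t i)) (g (t (i - 1))) = d (h (t i)) (h (t (i - 1)))"
      using assms[OF partition_in_interval[OF part]] by simp
  qed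
  then show ?thesis
    by (simp add: bounded_variation_def)
qed

text \<open>The increments of \<open>g\<close> telescope over every partition, so
  \<open>g b - g a\<close> bounds all the sums at once.\<close>

lemma bounded_variation_if_dist_le_increment:
  fixes g :: "real \<Rightarrow> real"
  assumes "\<And>s t. a \<le> s \<Longrightarrow> s \<le> t \<Longrightarrow> t \<le> b \<Longrightarrow> d (h t) (h s) \<le> g t - g s"
  shows "bounded_variation d a b h"
proof -
  have "total_variation d a b h \<le> ereal (g b - g a)"
    unfolding total_variation_def
  proof (rule SUP_least, clarify)
    fix n :: nat and t :: "nat \<Rightarrow> real"
    assume part: "(n, t) \<in> partitions a b"
    then have t: "t 0 = a" "t n = b"
      by (auto simp: partitions_def)
    have "(\<Sum>i=1..n. d (h (t i)) (h (t (i - 1)))) \<le> (\<Sum>i=1..n. g (t i) - g (t (i - 1)))"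
    proof (rule sum_mono)
      fix i assume "i \<in> {1..n}"
      then show "d (h (t i)) (h (t (i - 1))) \<le> g (t i) - g (t (i - 1))"
        using partition_in_interval[OF part, of i] partition_in_interval[OF part, of "i - 1"]
          partition_mono[OF part, of "i - 1" i]
        by (intro assms) auto
    qed
    also have "\<dots> = g b - g a"
      using t sum_telescope''[of 0 n "\<lambda>i. g (t i)"] by (simp add: atLeastSucAtMost_greaterThanAtMost)
    finally show "ereal (\<Sum>i=1..n. d (h (t i)) (h (t (i - 1)))) \<le> ereal (g b - g a)"
      by simp
  qed
  then show ?thesis
    unfolding bounded_variation_def by auto
qed

section \<open>Integrals against a monotone kernel\<close>

lemma integral_monotone_kernel:
  fixes k :: "real \<Rightarrow> 'x \<Rightarrow> real" and f :: "'x \<Rightarrow> real"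
  assumes meas: "\<And>t. t \<in> {a..b} \<Longrightarrow> (\<lambda>x. k t x * f x) \<in> borel_measurable M"
    and int: "integrable M (\<lambda>x. k b x * f x)"
    and nonneg: "\<And>t x. t \<in> {a..b} \<Longrightarrow> x \<in> space M \<Longrightarrow> 0 \<le> k t x"
    and mono: "\<And>s t x. a \<le> s \<Longrightarrow> s \<le> t \<Longrightarrow> t \<le> b \<Longrightarrow> x \<in> space M \<Longrightarrow> k s x \<le> k t x"
    and cont: "\<And>x. x \<in> space M \<Longrightarrow> continuous_on {a..b} (\<lambda>t. k t x)"
  shows "continuous_on {a..b} (\<lambda>t. c * (\<integral>x. k t x * f x \<partial>M))" (is ?cont)
    and "bounded_variation dist a b (\<lambda>t. c * (\<integral>x. k t x * f x \<partial>M))" (is ?bv)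
proof -
  have bound: "norm (k t x * f x) \<le> norm (k b x * f x)" if "t \<in> {a..b}" "x \<in> space M" for t x
    using that nonneg[of t x] nonneg[of b x] mono[of t b x]
    by (auto simp: abs_mult intro!: mult_right_mono)
  have int': "integrable M (\<lambda>x. k t x * f x)" if "t \<in> {a..b}" for t
    using bound[OF that] by (intro Bochner_Integration.integrable_bound[OF int meas[OF that]]) auto
  show ?cont
  proof (rule continuous_on_mult_left, rule continuous_on_sequentiallyI)
    fix u t assume u: "\<forall>n. u n \<in> {a..b}" and t: "t \<in> {a..b}" and lim: "u \<longlonglongrightarrow> t"
    show "(\<lambda>n. \<integral>x. k (u n) x * f x \<partial>M) \<longlonglongrightarrow> (\<integral>x. k t x * f x \<partial>M)"
    proof (rule integral_dominated_convergence[where w = "\<lambda>x. norm (k b x * f x)"])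
      show "AE x in M. (\<lambda>n. k (u n) x * f x) \<longlonglongrightarrow> k t x * f x"
        using continuous_on_tendsto_compose[OF cont lim t] u by (auto intro!: tendsto_mult_right)
      show "AE x in M. norm (k (u n) x * f x) \<le> norm (k b x * f x)" for n
        using bound u by auto
    qed (use meas t u int in auto)
  qed
  show ?bv
  proof (rule bounded_variation_if_dist_le_increment)
    fix s t assume st: "a \<le> s" "s \<le> t" "t \<le> b"
    have abs_int: "integrable M (\<lambda>x. k r x * \<bar>f x\<bar>)" if "r \<in> {a..b}" for r
      using integrable_abs[OF int'[OF that]] nonneg[OF that]
      by (simp add: abs_mult cong: Bochner_Integration.integrable_cong)
    have "\<bar>(\<integral>x. k t x * f x \<partial>M) - (\<integral>x. k s x * f x \<partial>M)\<bar> = \<bar>\<integral>x. k t x * f x - k s x * f x \<partial>M\<bar>"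
      using st by (subst Bochner_Integration.integral_diff) (auto intro!: int')
    also have "\<dots> \<le> (\<integral>x. \<bar>k t x * f x - k s x * f x\<bar> \<partial>M)"
      by (rule integral_abs_bound)
    \<comment> \<open>Monotonicity makes \<open>k t x - k s x\<close> nonnegative, so the absolute
      value falls on \<open>f x\<close> alone and the integral splits into an increment.\<close>
    also have "\<dots> = (\<integral>x. k t x * \<bar>f x\<bar> - k s x * \<bar>f x\<bar> \<partial>M)"
      using mono[OF st]
      by (intro Bochner_Integration.integral_cong)
        (auto simp: abs_mult simp flip: left_diff_distrib)
    also have "\<dots> = (\<integral>x. k t x * \<bar>f x\<bar> \<partial>M) - (\<integral>x. k s x * \<bar>f x\<bar> \<partial>M)"
      using st by (intro Bochner_Integration.integral_diff abs_int) auto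
    finally show "dist (c * (\<integral>x. k t x * f x \<partial>M)) (c * (\<integral>x. k s x * f x \<partial>M))
        \<le> \<bar>c\<bar> * (\<integral>x. k t x * \<bar>f x\<bar> \<partial>M) - \<bar>c\<bar> * (\<integral>x. k s x * \<bar>f x\<bar> \<partial>M)"
      by (auto simp: dist_real_def abs_mult intro!: mult_left_mono simp flip: right_diff_distrib)
  qed
qed

section \<open>The Katugampola kernel\<close>

text \<open>
  The \<open>max\<close> realises the extension by zero to \<open>x > t\<close> and keeps the kernel continuous in
  \<open>t\<close> even at \<open>t = 0\<close> with \<open>\<rho> < -1\<close>, where \<open>t powr (\<rho> + 1)\<close> jumps.
\<close>

definition katugampola_kernel :: "real \<Rightarrow> real \<Rightarrow> real \<Rightarrow> real \<Rightarrow> real" where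
  "katugampola_kernel \<rho> \<nu> t x =
     \<bar>max t x powr (\<rho> + 1) - x powr (\<rho> + 1)\<bar> powr (\<nu> - 1) * x powr \<rho>"

lemma katugampola_kernel_nonneg: "0 \<le> katugampola_kernel \<rho> \<nu> t x"
  by (simp add: katugampola_kernel_def)

text \<open>Real \<open>powr\<close> is 0 at base 0 for every exponent, zero and negative ones
  included, so the factor \<open>x powr \<rho>\<close> vanishes.\<close>

lemma katugampola_kernel_at_0 [simp]: "katugampola_kernel \<rho> \<nu> t 0 = 0"
  by (simp add: katugampola_kernel_def)

lemma katugampola_kernel_measurable [measurable]:
  "katugampola_kernel \<rho> \<nu> t \<in> borel_measurable borel"
  unfolding katugampola_kernel_def by measurable

text \<open>On positive reals the power is monotone, with a direction set by the sign of
  \<open>e\<close>. Either way, moving \<open>s\<close> to the right takes its power further from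
  that of \<open>x\<close>.\<close>

lemma abs_powr_diff_mono:
  fixes x s t e :: real
  assumes "0 < x" "x \<le> s" "s \<le> t"
  shows "\<bar>s powr e - x powr e\<bar> \<le> \<bar>t powr e - x powr e\<bar>"
proof (cases "0 \<le> e")
  case True
  then show ?thesis
    using assms powr_mono2[of e x s] powr_mono2[of e s t] by simp
next
  case False
  then show ?thesis
    using assms powr_mono2'[of e x s] powr_mono2'[of e s t] by simp
qed

lemma abs_powr_diff_antimono:
  fixes x c t e :: real
  assumes "0 < x" "x \<le> c" "c \<le> t"
  shows "\<bar>t powr e - c powr e\<bar> \<le> \<bar>t powr e - x powr e\<bar>"
proof (cases "0 \<le> e")
  case True
  then show ?thesis
    using assms powr_mono2[of e x c] powr_mono2[of e c t] by simp
next
  case False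
  then show ?thesis
    using assms powr_mono2'[of e x c] powr_mono2'[of e c t] by simp
qed

text \<open>Both \<open>max s x\<close> and \<open>max t x\<close> are at least \<open>x\<close>, so
  \<open>abs_powr_diff_mono\<close> applies even to \<open>s\<close> or \<open>t\<close> left of
  \<open>x\<close>.\<close>

lemma katugampola_kernel_mono:
  assumes "0 \<le> x" "s \<le> t" "\<nu> > 1"
  shows "katugampola_kernel \<rho> \<nu> s x \<le> katugampola_kernel \<rho> \<nu> t x"
proof (cases "x = 0")
  case False
  then show ?thesis
    using assms unfolding katugampola_kernel_def
    by (intro mult_right_mono powr_mono2 abs_powr_diff_mono) auto
qed simp

text \<open>For \<open>x > 0\<close> the base \<open>max t x\<close> stays positive, and the outer
  power is continuous at 0 because \<nu> - 1 is positive.\<close>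

lemma continuous_on_katugampola_kernel:
  assumes "0 \<le> x" "\<nu> > 1"
  shows "continuous_on A (\<lambda>t. katugampola_kernel \<rho> \<nu> t x)"
proof (cases "x = 0")
  case False
  then show ?thesis
    using assms unfolding katugampola_kernel_def
    by (intro continuous_intros continuous_on_powr') auto
qed simp

lemma katugampola_kernel_comparison:
  assumes "0 \<le> a" "a < t" "t \<le> b" "\<rho> \<noteq> -1" "\<nu> > 1"
  obtains C D where
    "\<And>x. x \<in> {a..b} \<Longrightarrow> katugampola_kernel \<rho> \<nu> b x \<le> C * katugampola_kernel \<rho> \<nu> t x + D"
    and "0 \<le> D"
proof -
  define e where "e = \<rho> + 1"
  \<comment> \<open>The midpoint is positive even for \<open>a = 0\<close>, so \<open>{c..b}\<close>
    avoids a singularity at 0, while points up to \<open>c\<close> keep a positive distance from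
    \<open>t\<close>.\<close>
  define c where "c = (a + t) / 2"
  have c: "0 < c" "a < c" "c < t" and e: "e \<noteq> 0"
    using assms by (auto simp: c_def e_def)
  define \<delta> where "\<delta> = \<bar>t powr e - c powr e\<bar>"
  have "\<delta> \<noteq> 0"
    using c e powr_less_mono2[of e c t] powr_less_mono2_neg[of e c t]
    by (cases e "0 :: real" rule: linorder_cases) (auto simp: \<delta>_def)
  then have \<delta>: "\<delta> > 0"
    by (simp add: \<delta>_def)
  \<comment> \<open>By the triangle inequality through \<open>t powr e\<close>, the difference at
    \<open>b\<close> exceeds the one at \<open>t\<close> by at most
    \<open>\<bar>b powr e - t powr e\<bar>\<close>. Left of \<open>c\<close> the difference at
    \<open>t\<close> is at least \<delta>, so this excess is a bounded multiple of it.\<close>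
  define \<gamma> where "\<gamma> = 1 + \<bar>b powr e - t powr e\<bar> / \<delta>"
  have near: "katugampola_kernel \<rho> \<nu> b x \<le> \<gamma> powr (\<nu> - 1) * katugampola_kernel \<rho> \<nu> t x"
    if "0 < x" "x \<le> c" for x
  proof -
    have "\<delta> \<le> \<bar>t powr e - x powr e\<bar>"
      unfolding \<delta>_def using that c by (intro abs_powr_diff_antimono) auto
    then have "\<bar>b powr e - t powr e\<bar> / \<delta> * \<bar>t powr e - x powr e\<bar> \<ge> \<bar>b powr e - t powr e\<bar>"
      using \<delta> mult_right_mono[of \<delta> "\<bar>t powr e - x powr e\<bar>" "\<bar>b powr e - t powr e\<bar>"]
      by (simp add: field_simps)
    then have "\<bar>b powr e - x powr e\<bar> \<le> \<gamma> * \<bar>t powr e - x powr e\<bar>"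
      by (simp add: \<gamma>_def algebra_simps)
    then have "\<bar>b powr e - x powr e\<bar> powr (\<nu> - 1) \<le> (\<gamma> * \<bar>t powr e - x powr e\<bar>) powr (\<nu> - 1)"
      using assms by (intro powr_mono2) auto
    also have "\<dots> = \<gamma> powr (\<nu> - 1) * \<bar>t powr e - x powr e\<bar> powr (\<nu> - 1)"
      by (rule powr_mult)
    finally show ?thesis
      using that c assms unfolding katugampola_kernel_def e_def
      by (simp add: max_def mult_right_mono flip: mult.assoc)
  qed
  have "continuous_on {c..b} (katugampola_kernel \<rho> \<nu> b)"
    unfolding katugampola_kernel_def using c assms
    by (intro continuous_intros continuous_on_powr') auto
  then have "bounded (katugampola_kernel \<rho> \<nu> b ` {c..b})"
    by (intro compact_imp_bounded compact_continuous_image) auto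
  then obtain D where D: "\<And>x. x \<in> {c..b} \<Longrightarrow> \<bar>katugampola_kernel \<rho> \<nu> b x\<bar> \<le> D"
    by (fastforce simp: bounded_iff)
  have "0 \<le> D"
    using D[of b] c assms by auto
  show thesis
  proof (rule that[OF _ \<open>0 \<le> D\<close>])
    fix x assume x: "x \<in> {a..b}"
    consider "x = 0" | "0 < x" "x \<le> c" | "x > c"
      using x assms by fastforce
    then show "katugampola_kernel \<rho> \<nu> b x
        \<le> \<gamma> powr (\<nu> - 1) * katugampola_kernel \<rho> \<nu> t x + D"
    proof cases
      case 2
      then show ?thesis
        using near[of x] \<open>0 \<le> D\<close> by linarith
    next
      case 3
      then have "katugampola_kernel \<rho> \<nu> b x \<le> D"
        using D[of x] x by auto
      moreover have "0 \<le> \<gamma> powr (\<nu> - 1) * katugampola_kernel \<rho> \<nu> t x"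
        by (simp add: katugampola_kernel_nonneg)
      ultimately show ?thesis by linarith
    qed (use \<open>0 \<le> D\<close> in simp)
  qed
qed

section \<open>The Katugampola integral of one integrable function\<close>

text \<open>For \<open>x > t\<close> the difference in the kernel is 0, and so is its power; hence
  the domain of integration can be fixed and \<open>t\<close> appears only in the integrand.\<close>

lemma katugampola_integral_eq_kernel:
  assumes "t \<in> {a..b}"
  shows "katugampola_integral a \<rho> \<nu> f t = (\<rho> + 1) powr (1 - \<nu>) / Gamma \<nu> *
    (\<integral>x. katugampola_kernel \<rho> \<nu> t x * f x \<partial>lebesgue_on {a..b})"
proof -
  let ?g = "\<lambda>x. (t powr (\<rho> + 1) - x powr (\<rho> + 1)) powr (\<nu> - 1) * x powr \<rho> * f x"
  have "lebesgue_on {a..t} = restrict_space (lebesgue_on {a..b}) {a..t}"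
    using assms by (subst restrict_restrict_space) (auto simp: Int_absorb1)
  moreover have "{a..t} \<inter> space (lebesgue_on {a..b}) \<in> sets (lebesgue_on {a..b})"
    by (auto simp: sets_restrict_space)
  ultimately have "(\<integral>x. ?g x \<partial>lebesgue_on {a..t})
      = (\<integral>x. indicator {a..t} x *\<^sub>R ?g x \<partial>lebesgue_on {a..b})"
    by (simp only: integral_restrict_space)
  also have "\<dots> = (\<integral>x. katugampola_kernel \<rho> \<nu> t x * f x \<partial>lebesgue_on {a..b})"
    by (intro Bochner_Integration.integral_cong)
      (auto simp: katugampola_kernel_def powr_abs max_def indicator_def)
  finally show ?thesis
    by (simp add: katugampola_integral_def)
qed

lemma katugampola_integral_continuous_bounded_variation:
  assumes "0 \<le> a" "a < b" "\<rho> \<noteq> -1" "\<nu> > 1" "integrable (lebesgue_on {a..b}) f"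
  shows "continuous_on {a..b} (katugampola_integral a \<rho> \<nu> f)
    \<and> bounded_variation dist a b (katugampola_integral a \<rho> \<nu> f)"
proof -
  let ?M = "lebesgue_on {a..b}" and ?k = "katugampola_kernel \<rho> \<nu>"
  let ?h = "\<lambda>t. (\<rho> + 1) powr (1 - \<nu>) / Gamma \<nu> * (\<integral>x. ?k t x * f x \<partial>?M)"
  have [measurable]: "f \<in> borel_measurable ?M"
    using assms by (rule_tac borel_measurable_integrable)
  have [measurable]: "?k t \<in> borel_measurable ?M" for t
    by (intro measurable_restrict_space1 measurable_completion) simp
  have "continuous_on {a..b} ?h \<and> bounded_variation dist a b ?h"
  proof (cases "integrable ?M (\<lambda>x. ?k b x * f x)")
    case True
    then show ?thesis
      using assms
      by (intro conjI integral_monotone_kernel)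
        (auto simp: katugampola_kernel_nonneg katugampola_kernel_mono
          intro!: continuous_on_katugampola_kernel)
  next
    case False
    \<comment> \<open>Integrability at one such \<open>t\<close> would carry over to
      \<open>b\<close>: in the comparison bound, the multiple of \<open>?k t\<close> is integrable
      against \<open>f\<close> by assumption, and the constant \<open>D\<close> because
      \<open>f\<close> is integrable.\<close>
    have "\<not> integrable ?M (\<lambda>x. ?k t x * f x)" if t: "a < t" "t \<le> b" for t
    proof
      assume int: "integrable ?M (\<lambda>x. ?k t x * f x)"
      obtain C D where C: "\<And>x. x \<in> {a..b} \<Longrightarrow> ?k b x \<le> C * ?k t x + D" and D: "0 \<le> D"
        using katugampola_kernel_comparison[OF assms(1) t assms(3,4)] by blast
      have "integrable ?M (\<lambda>x. C * \<bar>?k t x * f x\<bar> + D * \<bar>f x\<bar>)"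
        using int assms by auto
      moreover have "norm (?k b x * f x) \<le> norm (C * \<bar>?k t x * f x\<bar> + D * \<bar>f x\<bar>)"
        if "x \<in> {a..b}" for x
      proof -
        have "norm (?k b x * f x) \<le> (C * ?k t x + D) * \<bar>f x\<bar>"
          using C[OF that] by (auto simp: abs_mult katugampola_kernel_nonneg intro: mult_right_mono)
        also have "\<dots> = C * \<bar>?k t x * f x\<bar> + D * \<bar>f x\<bar>"
          by (simp add: abs_mult katugampola_kernel_nonneg algebra_simps)
        finally show ?thesis by simp
      qed
      ultimately have "integrable ?M (\<lambda>x. ?k b x * f x)"
        by (intro Bochner_Integration.integrable_bound[where g = "\<lambda>x. ?k b x * f x"]) auto
      with False show False ..
    qed
    \<comment> \<open>The comparison excludes \<open>t = a\<close>. There \<open>max a x = x\<close>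
      on the whole interval, so the kernel itself vanishes.\<close>
    moreover have "(\<integral>x. ?k a x * f x \<partial>?M) = (\<integral>x. 0 \<partial>?M)"
      by (rule Bochner_Integration.integral_cong) (auto simp: katugampola_kernel_def)
    ultimately have zero: "?h t = 0" if "t \<in> {a..b}" for t
      using that by (cases "t = a") (auto simp: not_integrable_integral_eq)
    have "continuous_on {a..b} ?h = continuous_on {a..b} (\<lambda>_. 0 :: real)"
      by (rule continuous_on_cong[OF refl zero])
    moreover have "bounded_variation dist a b ?h"
    proof (rule bounded_variation_if_dist_le_increment[where g = "\<lambda>_. 0"])
      fix s t assume "a \<le> s" "s \<le> t" "t \<le> b"
      then show "dist (?h t) (?h s) \<le> 0 - 0"
        using zero[of s] zero[of t] by auto
    qed
    ultimately show ?thesis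
      by simp
  qed
  moreover have "continuous_on {a..b} (katugampola_integral a \<rho> \<nu> f) = continuous_on {a..b} ?h"
    by (intro continuous_on_cong katugampola_integral_eq_kernel) auto
  moreover have "bounded_variation dist a b (katugampola_integral a \<rho> \<nu> f)
      = bounded_variation dist a b ?h"
    by (intro bounded_variation_cong katugampola_integral_eq_kernel) auto
  ultimately show ?thesis by simp
qed

section \<open>An integrable selection\<close>

text \<open>Compactness puts the supremum into \<open>F t\<close>. It exceeds \<open>c\<close>
  exactly when \<open>F t\<close> meets the open ray \<open>{c<..}\<close>, so set-valued
  measurability yields measurability of the supremum.\<close>

lemma Sup_integrable_selection:
  assumes F: "\<And>t. t \<in> {a..b} \<Longrightarrow> F t \<noteq> {} \<and> compact (F t)"
    and meas: "borel_measurable_set_valued a b F"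
    and bound: "integrably_bounded a b F"
  shows "(\<lambda>t. Sup (F t)) \<in> integrable_selections a b F"
proof -
  let ?f = "\<lambda>t. Sup (F t)"
  have mem: "?f t \<in> F t" if "t \<in> {a..b}" for t
    using F[OF that]
    by (intro closed_contains_Sup) (auto intro: compact_imp_closed compact_imp_bounded bounded_imp_bdd_above)
  have "?f \<in> borel_measurable (lebesgue_on {a..b})"
    unfolding borel_measurable_iff_greater
  proof
    fix c
    have "c < ?f t \<longleftrightarrow> F t \<inter> {c<..} \<noteq> {}" if "t \<in> {a..b}" for t
      using F[OF that] less_cSup_iff[of "F t" c]
        bounded_imp_bdd_above[OF compact_imp_bounded[of "F t"]]
      by auto
    then have "{t \<in> space (lebesgue_on {a..b}). c < ?f t} = {t \<in> {a..b}. F t \<inter> {c<..} \<noteq> {}}"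
      by auto
    moreover have "{t \<in> {a..b}. F t \<inter> {c<..} \<noteq> {}} \<in> sets borel"
      using meas by (auto simp: borel_measurable_set_valued_def)
    ultimately show "{t \<in> space (lebesgue_on {a..b}). c < ?f t} \<in> sets (lebesgue_on {a..b})"
      by (subst sets_restrict_space_iff) auto
  qed
  moreover obtain m where m: "integrable (lebesgue_on {a..b}) m"
    "\<And>t s. t \<in> {a..b} \<Longrightarrow> s \<in> F t \<Longrightarrow> \<bar>s\<bar> \<le> m t"
    using bound by (auto simp: integrably_bounded_def)
  moreover have "\<bar>?f t\<bar> \<le> \<bar>m t\<bar>" if "t \<in> {a..b}" for t
    using m(2)[OF that mem[OF that]] by simp
  ultimately have "integrable (lebesgue_on {a..b}) ?f"
    by (intro Bochner_Integration.integrable_bound[OF m(1)]) auto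
  then show ?thesis
    using mem by (auto simp: integrable_selections_def)
qed

theorem theorem5p2:
  fixes a b \<rho> \<nu> :: real and F :: "real \<Rightarrow> real set"
  assumes "0 \<le> a" and "a < b" and "\<rho> \<noteq> -1" and "\<nu> > 1"
    and "\<And>t. t \<in> {a..b} \<Longrightarrow> F t \<noteq> {} \<and> compact (F t) \<and> convex (F t)"
    and "borel_measurable_set_valued a b F"
    and "integrably_bounded a b F"
    and "bounded_variation hausdorff_metric a b F"
  shows "\<exists>h :: real \<Rightarrow> real.
           (\<forall>t\<in>{a..b}. h t \<in> set_katugampola_integral a b \<rho> \<nu> F t) \<and>
           continuous_on {a..b} h \<and>
           bounded_variation dist a b h"
proof -
  have f: "(\<lambda>t. Sup (F t)) \<in> integrable_selections a b F"
    using assms by (intro Sup_integrable_selection) auto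
  then have "integrable (lebesgue_on {a..b}) (\<lambda>t. Sup (F t))"
    by (simp add: integrable_selections_def)
  from katugampola_integral_continuous_bounded_variation[OF assms(1-4) this] f show ?thesis
    by (auto simp: set_katugampola_integral_def)
qed

end
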